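(* Let $p$ be prime and let $g\in\mathbb{C}^{\mathbb{Z}_p}\setminus\{0\}$ be such that (i) $\|f\|_0+\|V_gf\|_0\ge p^2+1$ for all $f\in\mathbb{C}^{\mathbb{Z}_p}\setminus\{0\}$, and (ii) for all $1\le k\le p$, $1\le l\le p^2$ with $k+l\ge p^2+1$ there is $f\in\mathbb{C}^{\mathbb{Z}_p}$ with $\|f\|_0=k$ and $\|V_gf\|_0=l$. Then any $f\in\mathbb{C}^{\mathbb{Z}_p}$ of the form $f=\sum_{\lambda\in\Lambda}c_\lambda\pi(\lambda)g$, with $\Lambda\subset\mathbb{Z}_p\times\widehat{\mathbb{Z}_p}$ and $c_\lambda\in\mathbb{C}$, is uniquely determined by $B\subseteq\mathbb{Z}_p$ and the restriction of $f$ to $B$ whenever $|B|\ge2|\Lambda|$ (without knowledge of $\Lambda$); that is, if $f=\sum_{\lambda\in\Lambda}c_\lambda\pi(\lambda)g$ and $f'=\sum_{\lambda\in\Lambda'}c'_\lambda\pi(\lambda)g$ with $\Lambda,\Lambda'\subset\mathbb{Z}_p\times\widehat{\mathbb{Z}_p}$, $|\Lambda'|\le|\Lambda|$, $|B|\ge2|\Lambda|$, and $f(y)=f'(y)$ for all $y\in B$, then $f=f'$.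
   Context: For a finite set $A$, $\mathbb{C}^A$ is the space of functions $f:A\to\mathbb{C}$, and $\|f\|_0=|\{a\in A: f(a)\ne 0\}|$. $\widehat{\mathbb{Z}_p}$ is the dual group of the cyclic group $\mathbb{Z}_p$ (homomorphisms $\xi:\mathbb{Z}_p\to\{z\in\mathbb{C}:|z|=1\}$, $\langle\xi,x\rangle=\xi(x)$). For $\lambda=(x,\xi)$, $\pi(\lambda)g(y)=\langle\xi,y\rangle g(y-x)$. The short-time Fourier transform of $f$ with respect to the window $g\neq0$ is $V_gf(x,\xi)=\sum_{y\in\mathbb{Z}_p}f(y)\,\overline{g(y-x)}\,\overline{\langle\xi,y\rangle}$, $(x,\xi)\in\mathbb{Z}_p\times\widehat{\mathbb{Z}_p}$. *)

theory Defs
  imports "HOL-Analysis.Analysis" "HOL-Algebra.Algebra"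
begin

text \<open>
  The cyclic group of order \<open>p\<close> is \<^const>\<open>integer_mod_group\<close>: carrier \<open>{0..<int p}\<close>, addition
  modulo \<open>p\<close>.  Groups are written multiplicatively, so the \<open>y - x\<close> of the additive notation is
  \<open>y \<otimes> inv x\<close>.  A function on a set \<open>A\<close> is an extensional HOL function (\<^const>\<open>undefined\<close>
  outside \<open>A\<close>), so that HOL equality of such functions is equality on \<open>A\<close>.
\<close>

definition fun_space :: "'a set \<Rightarrow> ('a \<Rightarrow> complex) set" where
  "fun_space A = (A \<rightarrow>\<^sub>E UNIV)"

definition zero_fun :: "'a set \<Rightarrow> 'a \<Rightarrow> complex" where
  "zero_fun A = (\<lambda>a\<in>A. 0)"

text \<open>The set \<open>A\<close> is an explicit argument because HOL functions do not carry their domain.\<close>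

definition norm0 :: "'a set \<Rightarrow> ('a \<Rightarrow> complex) \<Rightarrow> nat" where
  "norm0 A f = card {a \<in> A. f a \<noteq> 0}"

definition circle_group :: "complex monoid" where
  "circle_group = \<lparr>carrier = {z. cmod z = 1}, monoid.mult = (*), one = 1\<rparr>"

definition dual_group :: "('a, 'b) monoid_scheme \<Rightarrow> ('a \<Rightarrow> complex) monoid" where
  "dual_group G =
     \<lparr>carrier = hom G circle_group \<inter> extensional (carrier G),
      monoid.mult = (\<lambda>\<xi> \<eta>. \<lambda>x\<in>carrier G. \<xi> x * \<eta> x),
      one = (\<lambda>x\<in>carrier G. 1)\<rparr>"

definition phase_space :: "('a, 'b) monoid_scheme \<Rightarrow> ('a \<times> ('a \<Rightarrow> complex)) set" where
  "phase_space G = carrier G \<times> carrier (dual_group G)"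

definition tf_shift ::
    "('a, 'b) monoid_scheme \<Rightarrow> 'a \<times> ('a \<Rightarrow> complex) \<Rightarrow> ('a \<Rightarrow> complex) \<Rightarrow> 'a \<Rightarrow> complex" where
  "tf_shift G = (\<lambda>(x, \<xi>) g. \<lambda>y\<in>carrier G. \<xi> y * g (y \<otimes>\<^bsub>G\<^esub> inv\<^bsub>G\<^esub> x))"

definition stft ::
    "('a, 'b) monoid_scheme \<Rightarrow> ('a \<Rightarrow> complex) \<Rightarrow> ('a \<Rightarrow> complex) \<Rightarrow>
       'a \<times> ('a \<Rightarrow> complex) \<Rightarrow> complex" where
  "stft G g f = (\<lambda>(x, \<xi>)\<in>phase_space G.
     (\<Sum>y\<in>carrier G. f y * cnj (g (y \<otimes>\<^bsub>G\<^esub> inv\<^bsub>G\<^esub> x)) * cnj (\<xi> y)))"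

definition tf_combination ::
    "('a, 'b) monoid_scheme \<Rightarrow> ('a \<Rightarrow> complex) \<Rightarrow> ('a \<times> ('a \<Rightarrow> complex)) set \<Rightarrow>
       ('a \<times> ('a \<Rightarrow> complex) \<Rightarrow> complex) \<Rightarrow> 'a \<Rightarrow> complex" where
  "tf_combination G g \<Lambda> c = (\<lambda>y\<in>carrier G. \<Sum>\<mu>\<in>\<Lambda>. c \<mu> * tf_shift G \<mu> g y)"

text \<open>
  For finite \<open>G\<close> the phase space is finite, so \<^const>\<open>card\<close> and \<^const>\<open>sum\<close> never fall back
  to their default value \<open>0\<close> on subsets of it.
\<close>

lemma group_circle_group: "group circle_group"
proof (rule groupI)
  fix x assume "x \<in> carrier circle_group"
  moreover from this have "x \<noteq> 0"
    by (auto simp: circle_group_def)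
  ultimately show "\<exists>y\<in>carrier circle_group. y \<otimes>\<^bsub>circle_group\<^esub> x = \<one>\<^bsub>circle_group\<^esub>"
    by (intro bexI[of _ "inverse x"]) (auto simp: circle_group_def norm_inverse)
qed (auto simp: circle_group_def norm_mult)

lemma pow_circle_group: "z [^]\<^bsub>circle_group\<^esub> (n::nat) = z ^ n"
  by (induction n) (simp_all add: nat_pow_def circle_group_def)

lemma finite_dual_group:
  assumes "group G" "finite (carrier G)"
  shows "finite (carrier (dual_group G))"
proof -
  interpret group G by fact
  have pos: "order G > 0"
    using assms(2) by (simp add: order_gt_0_iff_finite)
  have "\<xi> x ^ order G = 1" if "\<xi> \<in> hom G circle_group" "x \<in> carrier G" for \<xi> x
  proof -
    interpret h: group_hom G circle_group \<xi>
      by (simp add: group_hom_def group_hom_axioms_def group_circle_group that assms)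
    have "\<xi> x [^]\<^bsub>circle_group\<^esub> order G = \<xi> (x [^]\<^bsub>G\<^esub> order G)"
      using that by (simp add: h.hom_nat_pow)
    also have "\<dots> = 1"
      using that h.hom_one by (simp add: pow_order_eq_1 circle_group_def)
    finally show ?thesis by (simp add: pow_circle_group)
  qed
  then have "carrier (dual_group G) \<subseteq> carrier G \<rightarrow>\<^sub>E {z. z ^ order G = 1}"
    by (auto simp: dual_group_def PiE_def)
  moreover have "finite {z::complex. z ^ order G = 1}"
    using pos by (intro finite_roots_unity) simp
  ultimately show ?thesis
    using assms(2) by (meson finite_PiE finite_subset)
qed

lemma finite_phase_space:
  "group G \<Longrightarrow> finite (carrier G) \<Longrightarrow> finite (phase_space G)"
  by (simp add: phase_space_def finite_dual_group)

end

theory Submission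
  imports Defs
begin

text \<open>
  By linearity, \<open>f - f'\<close> is a combination of time-frequency shifts of \<open>g\<close> over
  \<open>M = \<Lambda> \<union> \<Lambda>'\<close>, where \<open>|M| \<le> 2|\<Lambda>| \<le> |B|\<close>, and it vanishes on \<open>B\<close>; the coefficients have to
  be shown to be zero (\<open>tf_combination_coeffs_zero\<close>).

  After shrinking \<open>B\<close>, one has \<open>|B| = |M|\<close>.  If some coefficient \<open>d\<^sub>\<nu>\<close> is nonzero, the \<open>|M| - 1\<close>
  homogeneous linear equations \<open>V\<^sub>g u(\<mu>) = 0\<close> with \<open>\<mu> \<in> M - {\<nu>}\<close> have a solution \<open>u \<noteq> 0\<close>
  supported on \<open>B\<close> (\<open>underdetermined_system\<close>).  Pairing \<open>u\<close> with the combination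
  \<open>\<Sum>\<^sub>\<mu> d\<^sub>\<mu> \<pi>(\<mu>)g\<close>, which vanishes on the support of \<open>u\<close>, shows that \<open>V\<^sub>g u\<close> also vanishes at
  \<open>\<nu>\<close>.  Hence \<open>\<parallel>u\<parallel>\<^sub>0 + \<parallel>V\<^sub>g u\<parallel>\<^sub>0 \<le> |B| + (p\<^sup>2 - |M|) = p\<^sup>2\<close>, which contradicts the uncertainty
  principle (i).  The count uses that \<open>\<int>\<^sub>p\<close> has at most \<open>p\<close> characters.
\<close>

lemma underdetermined_system:
  fixes a :: "'b \<Rightarrow> 'a \<Rightarrow> 'k :: field"
  assumes "finite M" "finite B" "card M < card B"
  shows "\<exists>u. (\<exists>y\<in>B. u y \<noteq> 0) \<and> (\<forall>\<mu>\<in>M. (\<Sum>y\<in>B. a y \<mu> * u y) = 0)"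
  using assms
proof (induction M arbitrary: a B rule: finite_induct)
  case empty
  then have "B \<noteq> {}" by auto
  then show ?case by (intro exI[of _ "\<lambda>_. 1"]) auto
next
  case (insert m M)
  show ?case
  proof (cases "\<exists>z\<in>B. a z m \<noteq> 0")
    case False
    from insert obtain u where "\<exists>y\<in>B. u y \<noteq> 0" "\<forall>\<mu>\<in>M. (\<Sum>y\<in>B. a y \<mu> * u y) = 0"
      by (metis Suc_lessD card_insert_disjoint)
    with False show ?thesis by (intro exI[of _ u]) auto
  next
    case True
    then obtain z where z: "z \<in> B" "a z m \<noteq> 0" by blast
    \<comment> \<open>Gaussian elimination with the pivot \<open>a z m\<close> removes the equation \<open>m\<close> and the unknown \<open>z\<close>.\<close>
    define C where "C = B - {z}"
    have C: "finite C" "card M < card C" and B: "B = insert z C" "z \<notin> C"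
      using insert z by (auto simp: C_def)
    from insert.IH[OF C, of "\<lambda>y \<mu>. a y \<mu> - a y m / a z m * a z \<mu>"]
    obtain u where u: "\<exists>y\<in>C. u y \<noteq> 0"
      "\<And>\<mu>. \<mu> \<in> M \<Longrightarrow> (\<Sum>y\<in>C. (a y \<mu> - a y m / a z m * a z \<mu>) * u y) = 0"
      by blast
    define v where "v = u(z := - (\<Sum>y\<in>C. a y m * u y) / a z m)"
    have v_C: "(\<Sum>y\<in>C. a y \<mu> * v y) = (\<Sum>y\<in>C. a y \<mu> * u y)" for \<mu>
      using B by (intro sum.cong) (auto simp: v_def)
    have v_B: "(\<Sum>y\<in>B. a y \<mu> * v y)
        = (\<Sum>y\<in>C. a y \<mu> * u y) - a z \<mu> / a z m * (\<Sum>y\<in>C. a y m * u y)" for \<mu>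
      using B C v_C[of \<mu>] by (simp add: v_def field_simps)
    have "(\<Sum>y\<in>B. a y \<mu> * v y) = 0" if "\<mu> \<in> insert m M" for \<mu>
    proof (cases "\<mu> = m")
      case True
      then show ?thesis using v_B[of m] z by simp
    next
      case False
      then have "0 = (\<Sum>y\<in>C. (a y \<mu> - a y m / a z m * a z \<mu>) * u y)"
        using that u(2) by simp
      also have "\<dots> = (\<Sum>y\<in>B. a y \<mu> * v y)"
        unfolding v_B by (simp add: sum_subtractf sum_distrib_left algebra_simps)
      finally show ?thesis by simp
    qed
    moreover have "\<exists>y\<in>B. v y \<noteq> 0"
      using u(1) B by (auto simp: v_def)
    ultimately show ?thesis by blast
  qed
qed

lemma stft_eq_sum_tf_shift:
  assumes "\<mu> \<in> phase_space G"
  shows "stft G g f \<mu> = (\<Sum>y\<in>carrier G. f y * cnj (tf_shift G \<mu> g y))"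
  using assms
  by (auto simp: stft_def tf_shift_def mult_ac split: prod.splits intro!: sum.cong)

text \<open>
  Under the uncertainty principle, for \<open>|M| \<le> |B|\<close> the restrictions to \<open>B\<close> of the time-frequency
  shifts \<open>\<pi>(\<mu>)g\<close> with \<open>\<mu> \<in> M\<close> are linearly independent.
\<close>

lemma tf_combination_coeffs_zero:
  assumes G: "group G" "finite (carrier G)"
    and uncertainty: "\<And>u. u \<in> fun_space (carrier G) \<Longrightarrow> u \<noteq> zero_fun (carrier G) \<Longrightarrow>
      card (phase_space G) < norm0 (carrier G) u + norm0 (phase_space G) (stft G g u)"
    and M: "M \<subseteq> phase_space G" and B: "B \<subseteq> carrier G" and card: "card M \<le> card B"
    and vanish: "\<And>y. y \<in> B \<Longrightarrow> (\<Sum>\<mu>\<in>M. d \<mu> * tf_shift G \<mu> g y) = 0"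
    and \<nu>: "\<nu> \<in> M"
  shows "d \<nu> = 0"
proof (rule ccontr)
  assume d\<nu>: "d \<nu> \<noteq> 0"
  have fin: "finite M" "finite (phase_space G)"
    using finite_phase_space[OF G] M finite_subset by auto
  obtain C where C: "C \<subseteq> B" "card C = card M" "finite C"
    using obtain_subset_with_card_n[OF card] by metis
  have C_sub: "C \<subseteq> carrier G" using B C by blast
  have "card (M - {\<nu>}) < card C"
    using fin \<nu> C by (metis card_Diff1_less)
  then obtain v where v: "\<exists>y\<in>C. v y \<noteq> 0"
    "\<And>\<mu>. \<mu> \<in> M - {\<nu>} \<Longrightarrow> (\<Sum>y\<in>C. cnj (tf_shift G \<mu> g y) * v y) = 0"
    using underdetermined_system[of "M - {\<nu>}" C "\<lambda>y \<mu>. cnj (tf_shift G \<mu> g y)"] fin C by auto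
  define u where "u = (\<lambda>y\<in>carrier G. if y \<in> C then v y else 0)"
  have u: "u \<in> fun_space (carrier G)" "u \<noteq> zero_fun (carrier G)"
    using v(1) C_sub by (auto simp: u_def fun_space_def zero_fun_def fun_eq_iff)
  have stft_u: "stft G g u \<mu> = (\<Sum>y\<in>C. cnj (tf_shift G \<mu> g y) * v y)" if "\<mu> \<in> M" for \<mu>
  proof -
    have "stft G g u \<mu> = (\<Sum>y\<in>carrier G. u y * cnj (tf_shift G \<mu> g y))"
      using that M by (intro stft_eq_sum_tf_shift) auto
    also have "\<dots> = (\<Sum>y\<in>C. u y * cnj (tf_shift G \<mu> g y))"
      using G C_sub by (intro sum.mono_neutral_right) (auto simp: u_def)
    also have "\<dots> = (\<Sum>y\<in>C. cnj (tf_shift G \<mu> g y) * v y)"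
      using C_sub by (intro sum.cong) (auto simp: u_def)
    finally show ?thesis .
  qed
  have "(\<Sum>\<mu>\<in>M. cnj (d \<mu>) * stft G g u \<mu>)
      = (\<Sum>\<mu>\<in>M. \<Sum>y\<in>C. v y * cnj (d \<mu> * tf_shift G \<mu> g y))"
    by (auto simp: stft_u sum_distrib_left mult_ac intro!: sum.cong)
  also have "\<dots> = (\<Sum>y\<in>C. v y * cnj (\<Sum>\<mu>\<in>M. d \<mu> * tf_shift G \<mu> g y))"
    by (subst sum.swap) (simp add: sum_distrib_left)
  also have "\<dots> = 0"
    using vanish C by (intro sum.neutral ballI) (simp only: subset_iff complex_cnj_zero mult_zero_right)
  finally have "(\<Sum>\<mu>\<in>M. cnj (d \<mu>) * stft G g u \<mu>) = 0" .
  then have "stft G g u \<nu> = 0"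
    using v(2) d\<nu> fin \<nu> by (simp add: sum.remove[of M \<nu>] stft_u)
  then have "stft G g u \<mu> = 0" if "\<mu> \<in> M" for \<mu>
    using that v(2) stft_u by (cases "\<mu> = \<nu>") auto
  then have "norm0 (phase_space G) (stft G g u) \<le> card (phase_space G - M)"
    unfolding norm0_def using fin by (intro card_mono) auto
  also have "\<dots> = card (phase_space G) - card M"
    using M fin by (simp add: card_Diff_subset)
  finally have "norm0 (phase_space G) (stft G g u) + card M \<le> card (phase_space G)"
    using card_mono[OF fin(2) M] by linarith
  moreover have "norm0 (carrier G) u \<le> card C"
    unfolding norm0_def using C by (intro card_mono) (auto simp: u_def split: if_splits)
  ultimately show False
    using uncertainty[OF u] C by linarith
qed

lemma card_dual_integer_mod_group_le:
  assumes "0 < p"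
  shows "card (carrier (dual_group (integer_mod_group p))) \<le> p"
proof -
  define G where "G = integer_mod_group p"
  \<comment> \<open>The generator is \<open>1 mod p\<close>, since \<open>1\<close> is not in the carrier for \<open>p = 1\<close>.\<close>
  define s where "s = (1::int) mod int p"
  have carrier_G: "carrier G = {0..<int p}"
    using assms by (simp add: G_def carrier_integer_mod_group)
  have power: "\<xi> (int k mod int p) = \<xi> s ^ k" if "\<xi> \<in> hom G circle_group" for \<xi> k
  proof (induction k)
    case 0
    have "\<xi> \<one>\<^bsub>G\<^esub> = \<one>\<^bsub>circle_group\<^esub>"
      using that by (intro hom_one group_circle_group) (simp_all add: G_def)
    then show ?case by (simp add: G_def circle_group_def)
  next
    case (Suc k)
    have "int (Suc k) mod int p = s \<otimes>\<^bsub>G\<^esub> (int k mod int p)"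
      by (simp add: s_def G_def mod_add_eq add.commute)
    also have "\<xi> \<dots> = \<xi> s \<otimes>\<^bsub>circle_group\<^esub> \<xi> (int k mod int p)"
      using that assms by (intro hom_mult[OF that]) (auto simp: carrier_G s_def)
    finally show ?case using Suc by (simp add: circle_group_def)
  qed
  have "inj_on (\<lambda>\<xi>. \<xi> s) (carrier (dual_group G))"
  proof (rule inj_onI)
    fix \<xi> \<eta>
    assume \<xi>: "\<xi> \<in> carrier (dual_group G)" and \<eta>: "\<eta> \<in> carrier (dual_group G)"
      and eq: "\<xi> s = \<eta> s"
    show "\<xi> = \<eta>"
    proof (rule extensionalityI[of _ "carrier G"])
      fix x assume "x \<in> carrier G"
      then have "x = int (nat x) mod int p" by (simp add: carrier_G)
      then show "\<xi> x = \<eta> x"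
        using power[of \<xi> "nat x"] power[of \<eta> "nat x"] \<xi> \<eta> eq by (simp add: dual_group_def)
    qed (use \<xi> \<eta> in \<open>auto simp: dual_group_def\<close>)
  qed
  moreover have "(\<lambda>\<xi>. \<xi> s) ` carrier (dual_group G) \<subseteq> {z. z ^ p = 1}"
  proof clarify
    fix \<xi> assume "\<xi> \<in> carrier (dual_group G)"
    then have "\<xi> \<in> hom G circle_group" by (simp add: dual_group_def)
    from power[OF this, of p] power[OF this, of 0] show "\<xi> s ^ p = 1" by simp
  qed
  moreover have "finite {z::complex. z ^ p = 1}"
    using assms by (intro finite_roots_unity) simp
  ultimately have "card (carrier (dual_group G)) \<le> card {z::complex. z ^ p = 1}"
    by (rule card_inj_on_le)
  also have "\<dots> = p"
    using assms by (intro card_roots_unity_eq)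
  finally show ?thesis by (simp add: G_def)
qed

theorem theorem5p8:
  fixes p :: nat and g :: "int \<Rightarrow> complex"
  defines "G \<equiv> integer_mod_group p"
  assumes "Factorial_Ring.prime p"
    and "g \<in> fun_space (carrier G)" and "g \<noteq> zero_fun (carrier G)"
    and "\<And>f. f \<in> fun_space (carrier G) \<Longrightarrow> f \<noteq> zero_fun (carrier G) \<Longrightarrow>
           norm0 (carrier G) f + norm0 (phase_space G) (stft G g f) \<ge> p\<^sup>2 + 1"
    and "\<And>k l. 1 \<le> k \<Longrightarrow> k \<le> p \<Longrightarrow> 1 \<le> l \<Longrightarrow> l \<le> p\<^sup>2 \<Longrightarrow> k + l \<ge> p\<^sup>2 + 1 \<Longrightarrow>
           \<exists>f\<in>fun_space (carrier G).
             norm0 (carrier G) f = k \<and> norm0 (phase_space G) (stft G g f) = l"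
  shows "\<forall>\<Lambda> \<Lambda>' c c' B f f'.
           \<Lambda> \<subseteq> phase_space G \<longrightarrow> \<Lambda>' \<subseteq> phase_space G \<longrightarrow> B \<subseteq> carrier G \<longrightarrow>
           f = tf_combination G g \<Lambda> c \<longrightarrow> f' = tf_combination G g \<Lambda>' c' \<longrightarrow>
           card \<Lambda>' \<le> card \<Lambda> \<longrightarrow> card B \<ge> 2 * card \<Lambda> \<longrightarrow>
           (\<forall>y\<in>B. f y = f' y) \<longrightarrow> f = f'"
proof (intro allI impI)
  fix \<Lambda> \<Lambda>' c c' B f f'
  assume \<Lambda>: "\<Lambda> \<subseteq> phase_space G" and \<Lambda>': "\<Lambda>' \<subseteq> phase_space G" and B: "B \<subseteq> carrier G"
    and f: "f = tf_combination G g \<Lambda> c" and f': "f' = tf_combination G g \<Lambda>' c'"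
    and card: "card \<Lambda>' \<le> card \<Lambda>" "2 * card \<Lambda> \<le> card B"
    and eq: "\<forall>y\<in>B. f y = f' y"
  have p: "0 < p" using assms(2) by (rule prime_gt_0_nat)
  have G: "group G" "finite (carrier G)"
    using p by (simp_all add: G_def carrier_integer_mod_group)
  have "card (phase_space G) \<le> p * p"
    using card_dual_integer_mod_group_le[OF p] p
    by (simp add: phase_space_def card_cartesian_product G_def carrier_integer_mod_group)
  then have uncertainty:
    "card (phase_space G) < norm0 (carrier G) u + norm0 (phase_space G) (stft G g u)"
    if "u \<in> fun_space (carrier G)" "u \<noteq> zero_fun (carrier G)" for u
    using assms(5)[OF that] by (simp add: power2_eq_square)
  define M where "M = \<Lambda> \<union> \<Lambda>'"
  define d where "d \<mu> = (if \<mu> \<in> \<Lambda> then c \<mu> else 0) - (if \<mu> \<in> \<Lambda>' then c' \<mu> else 0)" for \<mu>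
  have M: "M \<subseteq> phase_space G" using \<Lambda> \<Lambda>' by (simp add: M_def)
  then have fin: "finite M" using finite_phase_space[OF G] by (rule finite_subset)
  have card_M: "card M \<le> card B"
    using card_Un_le[of \<Lambda> \<Lambda>'] card by (simp add: M_def)
  have diff: "f y - f' y = (\<Sum>\<mu>\<in>M. d \<mu> * tf_shift G \<mu> g y)" if "y \<in> carrier G" for y
  proof -
    have extend: "(\<Sum>\<mu>\<in>L. b \<mu> * tf_shift G \<mu> g y)
        = (\<Sum>\<mu>\<in>M. (if \<mu> \<in> L then b \<mu> else 0) * tf_shift G \<mu> g y)" if "L \<subseteq> M" for L b
      using fin that by (intro sum.mono_neutral_cong_left) auto
    show ?thesis
      using that by (simp add: f f' tf_combination_def d_def left_diff_distrib sum_subtractf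
          extend[of \<Lambda>] extend[of \<Lambda>'] M_def)
  qed
  have "d \<mu> = 0" if "\<mu> \<in> M" for \<mu>
  proof (rule tf_combination_coeffs_zero[OF G uncertainty M B card_M _ that])
    fix y assume "y \<in> B"
    then show "(\<Sum>\<mu>\<in>M. d \<mu> * tf_shift G \<mu> g y) = 0"
      using diff[of y] eq B by auto
  qed
  then have "f y = f' y" if "y \<in> carrier G" for y
    using diff[OF that] by simp
  then show "f = f'"
    by (intro extensionalityI[of f "carrier G"]) (auto simp: f f' tf_combination_def)
qed

end
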